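(* Let $\mathsf{G}$ be a group, $\mathbb{F}$ an algebraically closed field, and let $\mathfrak{A}$ and $\mathfrak{B}$ be two finite dimensional division $\mathsf{G}$-graded $\mathbb{F}$-algebras. Then $\mathsf{T}^{\mathsf{G}}(\mathfrak{A})\subseteq\mathsf{T}^{\mathsf{G}}(\mathfrak{B})$ if and only if $\mathfrak{B}\stackrel{\mathsf{G}}{\hookrightarrow}\mathfrak{A}$. In addition, $\mathsf{T}^{\mathsf{G}}(\mathfrak{A})=\mathsf{T}^{\mathsf{G}}(\mathfrak{B})$ if and only if $\mathfrak{A}\cong_{\mathsf{G}}\mathfrak{B}$.
   Context: Algebras are associative $\mathbb{F}$-algebras. A $\mathsf{G}$-grading on $\mathfrak{A}$ is a vector space decomposition $\mathfrak{A}=\bigoplus_{\xi\in\mathsf{G}}\mathfrak{A}_\xi$ with $\mathfrak{A}_\xi\mathfrak{A}_\zeta\subseteq\mathfrak{A}_{\xi\zeta}$. $\mathfrak{A}$ is division $\mathsf{G}$-graded if it is unitary and every nonzero homogeneous element is invertible in $\mathfrak{A}$. A $\mathsf{G}$-graded homomorphism $\psi:\mathfrak{B}\to\mathfrak{A}$ is an algebra homomorphism (not required to preserve units) with $\psi(\mathfrak{B}_\xi)\subseteq\mathfrak{A}_\xi$ for all $\xi\in\mathsf{G}$; $\mathfrak{B}\stackrel{\mathsf{G}}{\hookrightarrow}\mathfrak{A}$ means that there exists an injective one, and $\mathfrak{A}\cong_{\mathsf{G}}\mathfrak{B}$ means that there is an algebra isomorphism $\varphi$ with $\varphi(\mathfrak{A}_\xi)=\mathfrak{B}_\xi$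 for all $\xi$. $\mathbb{F}\langle X^{\mathsf{G}}\rangle$ is the free $\mathsf{G}$-graded associative algebra freely generated by $X^{\mathsf{G}}=\bigcup_{\xi\in\mathsf{G}}X_\xi$, $X_\xi=\{x_1^{(\xi)},x_2^{(\xi)},\dots\}$, where $x_i^{(\xi)}$ has degree $\xi$. $\mathsf{T}^{\mathsf{G}}(\mathfrak{A})$ is the set of graded polynomial identities of $\mathfrak{A}$: those $f\in\mathbb{F}\langle X^{\mathsf{G}}\rangle$ that vanish under every substitution of the variables $x_i^{(\xi)}$ by elements of $\mathfrak{A}_\xi$. *)

theory Defs
  imports
    "HOL-Library.Poly_Mapping"
    "HOL-Computational_Algebra.Polynomial"
begin

section \<open>Graded algebras\<close>

text \<open>
  The class \<open>ring\<close> does not require a unit, so neither do algebras. In particular the zero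
  algebra is an algebra, and it is unitary.
\<close>

locale assoc_algebra = vector_space scale
  for scale :: "'f::field \<Rightarrow> 'a::ring \<Rightarrow> 'a" (infixr \<open>*s\<close> 75) +
  assumes scale_mult_left: "(c *s x) * y = c *s (x * y)"
    and scale_mult_right: "x * (c *s y) = c *s (x * y)"

text \<open>
  The grading group is an arbitrary, not necessarily commutative group. It is an instance of
  the class \<open>group_add\<close>, hence written additively: the product \<open>\<xi>\<zeta>\<close> is \<open>\<xi> + \<zeta>\<close>.
\<close>

locale graded_algebra = assoc_algebra scale
  for scale :: "'f::field \<Rightarrow> 'a::ring \<Rightarrow> 'a" (infixr \<open>*s\<close> 75) +
  fixes A :: "'g::group_add \<Rightarrow> 'a set"
  assumes subspace_component: "subspace (A \<xi>)"
    and direct_sum: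
      "\<exists>!c. (\<forall>\<xi>. c \<xi> \<in> A \<xi>) \<and> finite {\<xi>. c \<xi> \<noteq> 0} \<and> x = (\<Sum>\<xi> | c \<xi> \<noteq> 0. c \<xi>)"
    and mult_component: "x \<in> A \<xi> \<Longrightarrow> y \<in> A \<zeta> \<Longrightarrow> x * y \<in> A (\<xi> + \<zeta>)"

locale division_graded_algebra = graded_algebra +
  assumes unitary_division:
    "\<exists>u. (\<forall>x. u * x = x \<and> x * u = x) \<and>
         (\<forall>\<xi>. \<forall>x\<in>A \<xi>. x \<noteq> 0 \<longrightarrow> (\<exists>y. x * y = u \<and> y * x = u))"

definition finite_dimensional :: "('f::field \<Rightarrow> 'a::ab_group_add \<Rightarrow> 'a) \<Rightarrow> bool" where
  "finite_dimensional scale \<longleftrightarrow> (\<exists>Basis. finite_dimensional_vector_space scale Basis)"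

definition algebra_hom ::
  "('f::field \<Rightarrow> 'b::ring \<Rightarrow> 'b) \<Rightarrow> ('f \<Rightarrow> 'a::ring \<Rightarrow> 'a) \<Rightarrow> ('b \<Rightarrow> 'a) \<Rightarrow> bool" where
  "algebra_hom scaleB scaleA \<psi> \<longleftrightarrow>
     Vector_Spaces.linear scaleB scaleA \<psi> \<and> (\<forall>x y. \<psi> (x * y) = \<psi> x * \<psi> y)"

definition graded_hom ::
  "('f::field \<Rightarrow> 'b::ring \<Rightarrow> 'b) \<Rightarrow> ('g::group_add \<Rightarrow> 'b set) \<Rightarrow>
   ('f \<Rightarrow> 'a::ring \<Rightarrow> 'a) \<Rightarrow> ('g \<Rightarrow> 'a set) \<Rightarrow> ('b \<Rightarrow> 'a) \<Rightarrow> bool" where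
  "graded_hom scaleB B scaleA A \<psi> \<longleftrightarrow>
     algebra_hom scaleB scaleA \<psi> \<and> (\<forall>\<xi>. \<psi> ` B \<xi> \<subseteq> A \<xi>)"

definition graded_embeds ::
  "('f::field \<Rightarrow> 'b::ring \<Rightarrow> 'b) \<Rightarrow> ('g::group_add \<Rightarrow> 'b set) \<Rightarrow>
   ('f \<Rightarrow> 'a::ring \<Rightarrow> 'a) \<Rightarrow> ('g \<Rightarrow> 'a set) \<Rightarrow> bool" where
  "graded_embeds scaleB B scaleA A \<longleftrightarrow> (\<exists>\<psi>. graded_hom scaleB B scaleA A \<psi> \<and> inj \<psi>)"

definition graded_isomorphic ::
  "('f::field \<Rightarrow> 'a::ring \<Rightarrow> 'a) \<Rightarrow> ('g::group_add \<Rightarrow> 'a set) \<Rightarrow>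
   ('f \<Rightarrow> 'b::ring \<Rightarrow> 'b) \<Rightarrow> ('g \<Rightarrow> 'b set) \<Rightarrow> bool" where
  "graded_isomorphic scaleA A scaleB B \<longleftrightarrow>
     (\<exists>\<phi>. algebra_hom scaleA scaleB \<phi> \<and> bij \<phi> \<and> (\<forall>\<xi>. \<phi> ` A \<xi> = B \<xi>))"

section \<open>The free algebra and graded identities\<close>

text \<open>
  Words in the variables, as a monoid under concatenation. The instance is additive because
  the multiplication of \<open>Poly_Mapping\<close> expects an additive monoid of exponents.
\<close>

datatype 'v free_word = Word (letters: "'v list")

instantiation free_word :: (type) monoid_add
begin

definition zero_free_word :: "'a free_word" where
  "0 = Word []"

definition plus_free_word :: "'a free_word \<Rightarrow> 'a free_word \<Rightarrow> 'a free_word" where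
  "u + v = Word (letters u @ letters v)"

instance
  by standard (auto simp: zero_free_word_def plus_free_word_def)

end

lemma letters_zero [simp]: "letters 0 = []"
  by (simp add: zero_free_word_def)

lemma letters_plus [simp]: "letters (u + v) = letters u @ letters v"
  by (simp add: plus_free_word_def)

lemma letters_eq_Nil_iff [simp]: "letters w = [] \<longleftrightarrow> w = 0"
  by (cases w) (auto simp: zero_free_word_def)

text \<open>
  \<open>'v free_word \<Rightarrow>\<^sub>0 'f\<close> is the free unital algebra. As algebras need not have a unit, the free
  algebra is its subalgebra of elements without constant term, and it has no unit itself.
  For unitary algebras this makes no difference to inclusions between sets of identities: a
  polynomial with nonzero constant term is an identity of the zero algebra only.
\<close>

definition free_algebra :: "('v free_word \<Rightarrow>\<^sub>0 'f::field) set" where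
  "free_algebra = {f. Poly_Mapping.lookup f 0 = 0}"

text \<open>
  The value of a word under the substitution \<open>\<sigma>\<close>. The empty word does not occur in elements of
  \<^const>\<open>free_algebra\<close>; its value is a dummy.
\<close>

fun eval_letters :: "('v \<Rightarrow> 'a::ring) \<Rightarrow> 'v list \<Rightarrow> 'a" where
  "eval_letters \<sigma> [] = 0"
| "eval_letters \<sigma> [v] = \<sigma> v"
| "eval_letters \<sigma> (v # w # ws) = \<sigma> v * eval_letters \<sigma> (w # ws)"

definition evaluation ::
  "('f::field \<Rightarrow> 'a::ring \<Rightarrow> 'a) \<Rightarrow> ('v \<Rightarrow> 'a) \<Rightarrow> ('v free_word \<Rightarrow>\<^sub>0 'f) \<Rightarrow> 'a" where
  "evaluation scale \<sigma> f =
     (\<Sum>w\<in>Poly_Mapping.keys f. scale (Poly_Mapping.lookup f w) (eval_letters \<sigma> (letters w)))"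

text \<open>
  The pair \<open>(i, \<xi>)\<close> is the variable \<open>x\<^sub>i\<close> of degree \<open>\<xi>\<close>; indices start from \<open>0\<close>.
\<close>

type_synonym 'g graded_var = "nat \<times> 'g"

definition graded_identities ::
  "('f::field \<Rightarrow> 'a::ring \<Rightarrow> 'a) \<Rightarrow> ('g::group_add \<Rightarrow> 'a set) \<Rightarrow>
   ('g graded_var free_word \<Rightarrow>\<^sub>0 'f) set" where
  "graded_identities scale A =
     {f \<in> free_algebra. \<forall>\<sigma>. (\<forall>i \<xi>. \<sigma> (i, \<xi>) \<in> A \<xi>) \<longrightarrow> evaluation scale \<sigma> f = 0}"

subsection \<open>Evaluation is the algebra homomorphism extending the substitution\<close>

lemma eval_letters_append:
  assumes "us \<noteq> []" "vs \<noteq> []"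
  shows "eval_letters \<sigma> (us @ vs) = eval_letters \<sigma> us * eval_letters \<sigma> vs"
  using assms
proof (induction us rule: induct_list012)
  case (2 x)
  then show ?case by (cases vs) auto
qed (auto simp: mult.assoc)

lemma free_algebra_mult: "f \<in> free_algebra \<Longrightarrow> f * g \<in> free_algebra"
proof -
  assume f: "f \<in> free_algebra"
  have "0 \<notin> Poly_Mapping.keys (f * g)"
  proof
    assume "0 \<in> Poly_Mapping.keys (f * g)"
    then obtain a b where "a \<in> Poly_Mapping.keys f" "0 = a + b"
      using keys_mult[of f g] by blast
    moreover from this have "letters a = []"
      by (metis append_is_Nil_conv letters_plus letters_zero)
    ultimately show False
      using f by (auto simp: free_algebra_def in_keys_iff)
  qed
  then show ?thesis
    by (simp add: free_algebra_def in_keys_iff)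
qed

lemma sum_of_monomials:
  "(\<Sum>w\<in>Poly_Mapping.keys f. Poly_Mapping.single w (Poly_Mapping.lookup f w)) = f"
  by (rule poly_mapping_eqI) (auto simp: lookup_sum lookup_single when_def in_keys_iff)

context assoc_algebra
begin

lemma eval_superset:
  assumes "finite S" "Poly_Mapping.keys f \<subseteq> S"
  shows "evaluation scale \<sigma> f =
    (\<Sum>w\<in>S. Poly_Mapping.lookup f w *s eval_letters \<sigma> (letters w))"
  unfolding evaluation_def using assms
  by (intro sum.mono_neutral_left) (auto simp: in_keys_iff)

lemma eval_add: "evaluation scale \<sigma> (f + g) = evaluation scale \<sigma> f + evaluation scale \<sigma> g"
  using keys_add[of f g]
    eval_superset[of "Poly_Mapping.keys f \<union> Poly_Mapping.keys g" f]
    eval_superset[of "Poly_Mapping.keys f \<union> Poly_Mapping.keys g" g]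
    eval_superset[of "Poly_Mapping.keys f \<union> Poly_Mapping.keys g" "f + g"]
  by (simp add: lookup_add scale_left_distrib sum.distrib)

lemma eval_zero: "evaluation scale \<sigma> 0 = 0"
  by (simp add: evaluation_def)

lemma eval_sum: "evaluation scale \<sigma> (\<Sum>i\<in>I. h i) = (\<Sum>i\<in>I. evaluation scale \<sigma> (h i))"
  by (induction I rule: infinite_finite_induct) (auto simp: eval_zero eval_add)

lemma eval_single: "evaluation scale \<sigma> (Poly_Mapping.single w c) = c *s eval_letters \<sigma> (letters w)"
  by (simp add: evaluation_def)

lemma eval_var: "evaluation scale \<sigma> (Poly_Mapping.single (Word [v]) 1) = \<sigma> v"
  by (simp add: eval_single)

lemma eval_scale: "evaluation scale \<sigma> (Poly_Mapping.single 0 c * f) = c *s evaluation scale \<sigma> f"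
proof -
  have "Poly_Mapping.single 0 c * f =
    (\<Sum>w\<in>Poly_Mapping.keys f. Poly_Mapping.single w (c * Poly_Mapping.lookup f w))"
    by (subst (1) sum_of_monomials[symmetric])
       (simp add: sum_distrib_left mult_single)
  then show ?thesis
    by (simp add: eval_sum eval_single evaluation_def[of scale \<sigma> f] scale_sum_right)
qed

lemma eval_mult:
  assumes "f \<in> free_algebra" "g \<in> free_algebra"
  shows "evaluation scale \<sigma> (f * g) = evaluation scale \<sigma> f * evaluation scale \<sigma> g"
proof -
  have nz: "u \<noteq> 0" "v \<noteq> 0" if "u \<in> Poly_Mapping.keys f" "v \<in> Poly_Mapping.keys g" for u v
    using assms that by (auto simp: free_algebra_def in_keys_iff)
  have "f * g = (\<Sum>u\<in>Poly_Mapping.keys f. \<Sum>v\<in>Poly_Mapping.keys g.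
      Poly_Mapping.single (u + v) (Poly_Mapping.lookup f u * Poly_Mapping.lookup g v))"
    by (subst (1) sum_of_monomials[of f, symmetric],
        subst (1) sum_of_monomials[of g, symmetric])
       (simp add: sum_product mult_single)
  then have "evaluation scale \<sigma> (f * g) = (\<Sum>u\<in>Poly_Mapping.keys f. \<Sum>v\<in>Poly_Mapping.keys g.
      (Poly_Mapping.lookup f u * Poly_Mapping.lookup g v) *s
      (eval_letters \<sigma> (letters u) * eval_letters \<sigma> (letters v)))"
    by (auto simp: eval_sum eval_single eval_letters_append nz intro!: sum.cong)
  also have "\<dots> = evaluation scale \<sigma> f * evaluation scale \<sigma> g"
    by (simp add: evaluation_def sum_product scale_mult_left scale_mult_right ab_semigroup_mult_class.mult.commute)
  finally show ?thesis .
qed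

end

end

theory Submission
  imports Defs
begin

text \<open>
  Since the field is algebraically closed, a nonzero component of a finite-dimensional division
  graded algebra is a line, so the algebra is a twisted group algebra of its support: it is determined
  by the structure constants of homogeneous vectors \<open>x(g)\<close>. An inclusion of identities gives an
  inclusion of supports, and each relation \<open>x(w) = s x(w')\<close> between monomials in two words with the
  same letters is a graded identity. Hence the quotient of the structure constants of the two
  algebras depends only on the exponent vectors of the words, which makes it a character on a
  subgroup of a free abelian group. The multiplicative group of the field is divisible, so this
  character extends to the whole group, and rescaling \<open>x(g)\<close> by its values turns the structure
  constants of one algebra into those of the other. For equal identities the supports agree, so the
  embedding is onto by counting dimensions in each degree.
\<close>

section \<open>Extension of characters\<close>

text \<open>The graph of a homomorphism from an additive subgroup to the multiplicative group of the
  field. As a relation it is extended by mere inclusion, and the condition at 0 makes it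
  single-valued. The ring \<open>'m\<close> supplies integer multiples in the form
  \<open>of_int k * v\<close>.\<close>

definition partial_character :: "('m::ring_1 \<times> 'f::field) set \<Rightarrow> bool" where
  "partial_character P \<longleftrightarrow>
     (0, 1) \<in> P \<and> (\<forall>c. (0, c) \<in> P \<longrightarrow> c = 1) \<and> (\<forall>v c. (v, c) \<in> P \<longrightarrow> c \<noteq> 0) \<and>
     (\<forall>v c w d. (v, c) \<in> P \<longrightarrow> (w, d) \<in> P \<longrightarrow> (v - w, c / d) \<in> P)"

context
  fixes P :: "('m::ring_1 \<times> 'f::field) set"
  assumes P: "partial_character P"
begin

lemma partial_character_zero: "(0, 1) \<in> P"
  and partial_character_trivial: "(0, c) \<in> P \<Longrightarrow> c = 1"
  and partial_character_nonzero: "(v, c) \<in> P \<Longrightarrow> c \<noteq> 0"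
  and partial_character_diff: "(v, c) \<in> P \<Longrightarrow> (w, d) \<in> P \<Longrightarrow> (v - w, c / d) \<in> P"
  using P unfolding partial_character_def by blast+

lemma partial_character_add:
  assumes "(v, c) \<in> P" "(w, d) \<in> P"
  shows "(v + w, c * d) \<in> P"
  using partial_character_diff[OF assms(1) partial_character_diff[OF partial_character_zero assms(2)]]
  by simp

lemma partial_character_unique:
  assumes "(v, c) \<in> P" "(v, d) \<in> P"
  shows "c = d"
  using partial_character_diff[OF assms] partial_character_trivial[of "c / d"] by auto

lemma partial_character_of_nat_mult:
  assumes "(v, c) \<in> P"
  shows "(of_nat n * v, c ^ n) \<in> P"
proof (induction n)
  case (Suc n)
  then show ?case using partial_character_add[OF assms] by (simp add: distrib_right)
qed (use partial_character_zero in simp)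

lemma partial_character_of_int_mult:
  assumes "(v, c) \<in> P"
  shows "(of_int k * v, c powi k) \<in> P"
proof (cases k)
  case (nonneg n)
  then show ?thesis using partial_character_of_nat_mult[OF assms] by simp
next
  case (neg n)
  then show ?thesis
    using partial_character_diff[OF partial_character_zero
        partial_character_of_nat_mult[OF assms, of "Suc n"]]
    by (simp add: power_int_minus field_simps del: power_Suc of_nat_Suc of_int_minus of_int_of_nat_eq)
       (simp add: algebra_simps)
qed

end

text \<open>
  If \<open>n > 0\<close> generates the ideal of all \<open>k\<close> with \<open>k q\<close> in the domain, then \<open>c\<close> has to be an
  \<open>n\<close>-th root of the value at \<open>n q\<close>; if the ideal is trivial, then \<open>c\<close> is arbitrary.
\<close>

lemma partial_character_compatible_value:
  fixes P :: "('m::ring_1 \<times> 'f::alg_closed_field) set"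
  assumes P: "partial_character P"
  obtains c where "c \<noteq> 0" "\<And>k d. (of_int k * q, d) \<in> P \<Longrightarrow> d = c powi k"
proof (cases "\<exists>n>0. \<exists>d. (of_nat n * q, d) \<in> P")
  case False
  have "k = 0" if k: "(of_int k * q, d) \<in> P" for k d
  proof (rule ccontr)
    assume "k \<noteq> 0"
    have neg: "(- (of_int k * q), 1 / d) \<in> P"
      using partial_character_diff[OF P partial_character_zero[OF P] k] by simp
    show False
    proof (cases "k > 0")
      case True
      then have "(of_nat (nat k) * q, d) \<in> P" using k by simp
      then show False using False True by (metis zero_less_nat_eq)
    next
      case nonpos: False
      then have "(of_nat (nat (- k)) * q, 1 / d) \<in> P" using neg by simp
      moreover have "nat (- k) > 0" using nonpos \<open>k \<noteq> 0\<close> by simp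
      ultimately show False using False by blast
    qed
  qed
  moreover from this have "d = 1" if "(of_int k * q, d) \<in> P" for k d
    using that partial_character_trivial[OF P, of d] by fastforce
  ultimately show ?thesis
    using that[of 1] by simp
next
  case True
  then obtain n b where n: "n > 0" and b: "(of_nat n * q, b) \<in> P"
    and "\<forall>m<n. \<not> (m > 0 \<and> (\<exists>d. (of_nat m * q, d) \<in> P))"
    using exists_least_iff[of "\<lambda>n. n > 0 \<and> (\<exists>d. (of_nat n * q, d) \<in> P)"] by blast
  then have least: "n \<le> m" if "m > 0" "(of_nat m * q, d) \<in> P" for m d
    using that by (meson not_le)
  obtain c where c: "c ^ n = b" using nth_root_exists[of n b] n by auto
  have "c \<noteq> 0" using c n partial_character_nonzero[OF P b] by auto
  moreover have "d = c powi k" if k: "(of_int k * q, d) \<in> P" for k d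
  proof -
    \<comment> \<open>Division with remainder: the multiple of \<open>q\<close> by \<open>r\<close>
      is a difference of two elements of the domain, so minimality of \<open>n\<close> forces
      \<open>r = 0\<close>.\<close>
    define j r where "j = k div int n" and "r = k mod int n"
    have kjr: "k = int n * j + r" by (simp add: j_def r_def)
    have "0 \<le> r" "r < int n" using n by (auto simp: r_def)
    have nj: "(of_int j * (of_nat n * q), b powi j) \<in> P"
      by (rule partial_character_of_int_mult[OF P b])
    have "of_int (j * int n) = (of_int j * of_nat n :: 'm)" by simp
    then have eq: "of_int j * (of_nat n * q) = of_int (int n * j) * q"
      by (simp only: mult.assoc mult.commute[of "int n" j])
    have "of_int k * q - of_int (int n * j) * q = of_int r * q"
      by (simp only: kjr of_int_add distrib_right add_diff_cancel_left')
    then have "(of_nat (nat r) * q, d / b powi j) \<in> P"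
      using partial_character_diff[OF P k nj] \<open>0 \<le> r\<close> by (simp add: eq)
    with least have "nat r > 0 \<Longrightarrow> n \<le> nat r" by blast
    then have "r = 0" using \<open>0 \<le> r\<close> \<open>r < int n\<close> by linarith
    then have "k = int n * j" using kjr by simp
    then have "d = b powi j"
      using partial_character_unique[OF P k] nj eq by simp
    then show ?thesis
      by (simp add: \<open>k = int n * j\<close> power_int_mult c)
  qed
  ultimately show ?thesis using that by blast
qed

text \<open>Adjoining \<open>q\<close> to the domain produces the vectors
  \<open>v + of_int k * q\<close>. Sending them to \<open>d * c powi k\<close> is well defined
  because \<open>c\<close> is chosen to agree with \<open>P\<close> on all multiples of
  \<open>q\<close> already in the domain.\<close>

lemma partial_character_extend:
  fixes P :: "('m::ring_1 \<times> 'f::alg_closed_field) set"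
  assumes P: "partial_character P"
  obtains Q c where "partial_character Q" "P \<subseteq> Q" "(q, c) \<in> Q"
proof -
  obtain c where c0: "c \<noteq> 0" and c: "\<And>k d. (of_int k * q, d) \<in> P \<Longrightarrow> d = c powi k"
    by (rule partial_character_compatible_value[OF P, of q]) (rule that)
  define Q where "Q = {(v + of_int k * q, d * c powi k) | v d k. (v, d) \<in> P}"
  have "partial_character Q"
    unfolding partial_character_def
  proof (intro conjI allI impI)
    show "(0, 1) \<in> Q"
      unfolding Q_def using partial_character_zero[OF P]
      by (intro CollectI exI[of _ "0 :: 'm"] exI[of _ "1 :: 'f"] exI[of _ "0 :: int"]) simp
  next
    fix b assume "(0, b) \<in> Q"
    then obtain v d k where vdk: "v + of_int k * q = 0" "b = d * c powi k" "(v, d) \<in> P"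
      unfolding Q_def by auto
    \<comment> \<open>An expression of 0 puts a multiple of \<open>q\<close> into the domain of
      \<open>P\<close>, where the choice of \<open>c\<close> fixes the value.\<close>
    have "v = of_int (- k) * q" using vdk(1) by (metis eq_neg_iff_add_eq_0 mult_minus_left of_int_minus)
    with vdk(3) have "d = c powi (- k)" by (intro c) simp
    then show "b = 1" using vdk(2) c0 by (simp add: power_int_minus)
  next
    fix v b assume "(v, b) \<in> Q"
    then show "b \<noteq> 0"
      unfolding Q_def using partial_character_nonzero[OF P] c0 by auto
  next
    fix v1 b1 v2 b2 assume "(v1, b1) \<in> Q" "(v2, b2) \<in> Q"
    then obtain w1 d1 k1 w2 d2 k2 where
      1: "v1 = w1 + of_int k1 * q" "b1 = d1 * c powi k1" "(w1, d1) \<in> P" and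
      2: "v2 = w2 + of_int k2 * q" "b2 = d2 * c powi k2" "(w2, d2) \<in> P"
      unfolding Q_def by blast
    have "v1 - v2 = (w1 - w2) + of_int (k1 - k2) * q"
      by (simp add: 1(1) 2(1) left_diff_distrib)
    moreover have "b1 / b2 = (d1 / d2) * c powi (k1 - k2)"
      using c0 by (simp add: 1(2) 2(2) power_int_diff)
    ultimately show "(v1 - v2, b1 / b2) \<in> Q"
      unfolding Q_def using partial_character_diff[OF P 1(3) 2(3)] by blast
  qed
  moreover have "P \<subseteq> Q"
  proof
    fix p assume "p \<in> P"
    then show "p \<in> Q"
      unfolding Q_def
      by (intro CollectI exI[of _ "fst p"] exI[of _ "snd p"] exI[of _ 0]) simp
  qed
  moreover have "(q, c) \<in> Q"
    unfolding Q_def using partial_character_zero[OF P]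
    by (intro CollectI exI[of _ 0] exI[of _ "1 :: 'f"] exI[of _ "1 :: int"]) simp
  ultimately show ?thesis using that by blast
qed

text \<open>The multiplicative group of an algebraically closed field is divisible, hence injective.\<close>

lemma character_extension:
  fixes P :: "('m::ring_1 \<times> 'f::alg_closed_field) set"
  assumes P: "partial_character P"
  obtains \<chi> where "\<And>v. \<chi> v \<noteq> 0" "\<And>v w. \<chi> (v + w) = \<chi> v * \<chi> w"
    "\<And>v w. \<chi> (v - w) = \<chi> v / \<chi> w" "\<And>v c. (v, c) \<in> P \<Longrightarrow> \<chi> v = c"
proof -
  \<comment> \<open>Zorn's lemma for the extensions of \<open>P\<close>. The union of a chain is
    again one, since any two of its pairs lie in a common member.\<close>
  have "\<exists>M\<in>{Q. partial_character Q \<and> P \<subseteq> Q}.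
      \<forall>X\<in>{Q. partial_character Q \<and> P \<subseteq> Q}. M \<subseteq> X \<longrightarrow> X = M"
  proof (rule subset_Zorn_nonempty)
    show "{Q. partial_character Q \<and> P \<subseteq> Q} \<noteq> {}" using P by auto
  next
    fix C assume ne: "C \<noteq> {}" and chain: "subset.chain {Q. partial_character Q \<and> P \<subseteq> Q} C"
    have C: "partial_character Q \<and> P \<subseteq> Q" if "Q \<in> C" for Q
      using chain that unfolding subset.chain_def by auto
    have "(v - w, c / d) \<in> \<Union>C" if vw: "(v, c) \<in> \<Union>C" "(w, d) \<in> \<Union>C" for v w c d
    proof -
      obtain Q1 Q2 where "Q1 \<in> C" "(v, c) \<in> Q1" "Q2 \<in> C" "(w, d) \<in> Q2" using vw by blast
      moreover from this have "Q1 \<subseteq> Q2 \<or> Q2 \<subseteq> Q1"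
        using chain unfolding subset.chain_def by blast
      ultimately obtain Q where "Q \<in> C" "(v, c) \<in> Q" "(w, d) \<in> Q" by blast
      then show ?thesis using C partial_character_diff by blast
    qed
    moreover have "(0, 1) \<in> \<Union>C" using ne C partial_character_zero by blast
    moreover have "c = 1" if "(0, c) \<in> \<Union>C" for c
      using that C partial_character_trivial by blast
    moreover have "c \<noteq> 0" if "(v, c) \<in> \<Union>C" for v c
      using that C partial_character_nonzero by blast
    moreover have "P \<subseteq> \<Union>C" using ne C by blast
    ultimately show "\<Union>C \<in> {Q. partial_character Q \<and> P \<subseteq> Q}"
      unfolding partial_character_def by blast
  qed
  then obtain M where M: "partial_character M" "P \<subseteq> M"
    and max: "\<And>X. partial_character X \<Longrightarrow> M \<subseteq> X \<Longrightarrow> X = M"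
    by (smt (verit) mem_Collect_eq subset_trans)
  \<comment> \<open>Adjoining a vector outside the domain would properly enlarge the maximal
    extension.\<close>
  have total: "\<exists>c. (v, c) \<in> M" for v
    using partial_character_extend[OF M(1), of v] max by metis
  define \<chi> where "\<chi> v = (SOME c. (v, c) \<in> M)" for v
  have \<chi>: "(v, \<chi> v) \<in> M" for v
    unfolding \<chi>_def using total by (rule someI_ex)
  have eq: "\<chi> v = c" if "(v, c) \<in> M" for v c
    using partial_character_unique[OF M(1) \<chi> that] .
  show ?thesis
  proof
    show "\<chi> v \<noteq> 0" for v using partial_character_nonzero[OF M(1) \<chi>] .
    show "\<chi> (v + w) = \<chi> v * \<chi> w" for v w
      by (rule eq) (rule partial_character_add[OF M(1) \<chi> \<chi>])
    show "\<chi> (v - w) = \<chi> v / \<chi> w" for v w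
      by (rule eq) (rule partial_character_diff[OF M(1) \<chi> \<chi>])
    show "\<chi> v = c" if "(v, c) \<in> P" for v c using that M(2) eq by blast
  qed
qed

section \<open>Homogeneous components\<close>

context graded_algebra
begin

definition component where
  "component x = (THE c. (\<forall>\<xi>. c \<xi> \<in> A \<xi>) \<and> finite {\<xi>. c \<xi> \<noteq> 0} \<and> x = (\<Sum>\<xi> | c \<xi> \<noteq> 0. c \<xi>))"

lemma component_in: "component x \<xi> \<in> A \<xi>"
  and finite_component: "finite {\<xi>. component x \<xi> \<noteq> 0}"
  and sum_component: "(\<Sum>\<xi> | component x \<xi> \<noteq> 0. component x \<xi>) = x"
  using theI'[OF direct_sum, of x] unfolding component_def by auto

text \<open>This is uniqueness of the decomposition. Since \<open>S\<close> may exceed the support,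
  components of a sum can be computed over the union of two supports, even if terms cancel.\<close>

lemma component_eqI:
  assumes "\<And>\<xi>. c \<xi> \<in> A \<xi>" "finite S" "\<And>\<xi>. \<xi> \<notin> S \<Longrightarrow> c \<xi> = 0" "x = (\<Sum>\<xi>\<in>S. c \<xi>)"
  shows "component x = c"
proof -
  have sub: "{\<xi>. c \<xi> \<noteq> 0} \<subseteq> S" using assms(3) by blast
  then have "finite {\<xi>. c \<xi> \<noteq> 0}" using assms(2) finite_subset by blast
  moreover have "x = (\<Sum>\<xi> | c \<xi> \<noteq> 0. c \<xi>)"
    unfolding assms(4) using sub assms(2) by (intro sum.mono_neutral_right) auto
  ultimately show ?thesis
    unfolding component_def using assms(1) by (intro the1_equality[OF direct_sum]) blast
qed

lemma sum_component_superset: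
  assumes "finite S" "{\<xi>. component x \<xi> \<noteq> 0} \<subseteq> S"
  shows "(\<Sum>\<xi>\<in>S. component x \<xi>) = x"
  by (subst (2) sum_component[symmetric]) (use assms in \<open>intro sum.mono_neutral_right, auto\<close>)

lemma component_homogeneous:
  assumes "x \<in> A \<xi>"
  shows "component x = (\<lambda>\<zeta>. if \<zeta> = \<xi> then x else 0)"
  by (rule component_eqI[of _ "{\<xi>}"]) (use assms subspace_component subspace_0 in auto)

lemma component_add: "component (x + y) \<xi> = component x \<xi> + component y \<xi>"
proof -
  define S where "S = {\<xi>. component x \<xi> \<noteq> 0} \<union> {\<xi>. component y \<xi> \<noteq> 0}"
  have S: "finite S" unfolding S_def using finite_component by blast
  have "component (x + y) = (\<lambda>\<xi>. component x \<xi> + component y \<xi>)"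
  proof (rule component_eqI)
    show "x + y = (\<Sum>\<xi>\<in>S. component x \<xi> + component y \<xi>)"
      using S sum_component_superset[of S] by (simp add: sum.distrib S_def)
  qed (use S component_in subspace_component subspace_add in \<open>auto simp: S_def\<close>)
  then show ?thesis by simp
qed

lemma component_scale: "component (c *s x) \<xi> = c *s component x \<xi>"
proof -
  have "component (c *s x) = (\<lambda>\<xi>. c *s component x \<xi>)"
  proof (rule component_eqI)
    show "c *s x = (\<Sum>\<xi> | component x \<xi> \<noteq> 0. c *s component x \<xi>)"
      by (simp add: sum_component flip: scale_sum_right)
  qed (use finite_component component_in subspace_component subspace_scale in auto)
  then show ?thesis by simp
qed

text \<open>Reduces the construction of an embedding to homogeneous elements. The degree is an
  argument of \<open>f\<close> because 0 lies in every component and so does not determine it. The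
  extension adds up the images of the components.\<close>

lemma graded_linear_extension:
  assumes C: "graded_algebra scaleC C"
    and f: "\<And>\<xi> x. x \<in> A \<xi> \<Longrightarrow> f \<xi> x \<in> C \<xi>"
    and add: "\<And>\<xi> x y. x \<in> A \<xi> \<Longrightarrow> y \<in> A \<xi> \<Longrightarrow> f \<xi> (x + y) = f \<xi> x + f \<xi> y"
    and scale: "\<And>\<xi> x c. x \<in> A \<xi> \<Longrightarrow> f \<xi> (c *s x) = scaleC c (f \<xi> x)"
    and mult: "\<And>\<xi> \<zeta> x y. x \<in> A \<xi> \<Longrightarrow> y \<in> A \<zeta> \<Longrightarrow> f (\<xi> + \<zeta>) (x * y) = f \<xi> x * f \<zeta> y"
    and inj: "\<And>\<xi> x. x \<in> A \<xi> \<Longrightarrow> f \<xi> x = 0 \<Longrightarrow> x = 0"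
  shows "graded_embeds scale A scaleC C"
proof -
  interpret C: graded_algebra scaleC C by fact
  have f0: "f \<xi> 0 = 0" for \<xi>
    using scale[of 0 \<xi> 0] subspace_component subspace_0 by simp
  define \<psi> where "\<psi> x = (\<Sum>\<xi> | component x \<xi> \<noteq> 0. f \<xi> (component x \<xi>))" for x
  have \<psi>_superset: "\<psi> x = (\<Sum>\<xi>\<in>S. f \<xi> (component x \<xi>))"
    if "finite S" "{\<xi>. component x \<xi> \<noteq> 0} \<subseteq> S" for x S
    unfolding \<psi>_def using that f0 by (intro sum.mono_neutral_left) auto
  have \<psi>_hom: "\<psi> x = f \<xi> x" if "x \<in> A \<xi>" for x \<xi>
  proof -
    have "{\<zeta>. component x \<zeta> \<noteq> 0} \<subseteq> {\<xi>}"
      by (auto simp: component_homogeneous[OF that])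
    then show ?thesis
      using \<psi>_superset[of "{\<xi>}" x] by (simp add: component_homogeneous[OF that])
  qed
  have \<psi>_add: "\<psi> (x + y) = \<psi> x + \<psi> y" for x y
  proof -
    define S where "S = {\<xi>. component x \<xi> \<noteq> 0} \<union> {\<xi>. component y \<xi> \<noteq> 0}"
    have "finite S" unfolding S_def using finite_component by blast
    moreover have "{\<xi>. component (x + y) \<xi> \<noteq> 0} \<subseteq> S"
      by (auto simp: S_def component_add)
    ultimately show ?thesis
      using \<psi>_superset[of S x] \<psi>_superset[of S y] \<psi>_superset[of S "x + y"]
      by (simp add: S_def component_add add component_in sum.distrib)
  qed
  have \<psi>_scale: "\<psi> (c *s x) = scaleC c (\<psi> x)" for c x
    using \<psi>_superset[of "{\<xi>. component x \<xi> \<noteq> 0}" "c *s x"]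
    by (auto simp: \<psi>_def component_scale scale component_in C.scale_sum_right finite_component)
  have lin: "Vector_Spaces.linear scale scaleC \<psi>"
    using \<psi>_add \<psi>_scale by unfold_locales auto
  interpret lin: Vector_Spaces.linear scale scaleC \<psi> by fact
  have \<psi>_mult: "\<psi> (x * y) = \<psi> x * \<psi> y" for x y
  proof -
    let ?S = "{\<xi>. component x \<xi> \<noteq> 0}" and ?T = "{\<xi>. component y \<xi> \<noteq> 0}"
    have "x * y = (\<Sum>\<xi>\<in>?S. \<Sum>\<zeta>\<in>?T. component x \<xi> * component y \<zeta>)"
      by (metis sum_component sum_product)
    then have "\<psi> (x * y) = (\<Sum>\<xi>\<in>?S. \<Sum>\<zeta>\<in>?T. \<psi> (component x \<xi> * component y \<zeta>))"
      by (simp add: lin.sum)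
    also have "\<dots> = (\<Sum>\<xi>\<in>?S. \<Sum>\<zeta>\<in>?T. f \<xi> (component x \<xi>) * f \<zeta> (component y \<zeta>))"
      by (simp add: \<psi>_hom[OF mult_component[OF component_in component_in]] mult component_in)
    also have "\<dots> = \<psi> x * \<psi> y"
      by (simp add: \<psi>_def sum_product)
    finally show ?thesis .
  qed
  have inj_0: "x = 0" if "\<psi> x = 0" for x
  proof -
    \<comment> \<open>The images \<open>f \<xi> (component x \<xi>)\<close> lie in different
      degrees, so they are the components of \<open>\<psi> x\<close> and vanish separately.\<close>
    have "C.component (\<psi> x) = (\<lambda>\<xi>. f \<xi> (component x \<xi>))"
      by (rule C.component_eqI[OF _ finite_component[of x]])
         (use f component_in f0 in \<open>auto simp: \<psi>_def\<close>)
    moreover have "C.component 0 = (\<lambda>\<xi>. 0)"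
      by (rule C.component_eqI[of _ "{}"]) (use C.subspace_component C.subspace_0 in auto)
    ultimately have "f \<xi> (component x \<xi>) = 0" for \<xi>
      using that by (metis (full_types))
    then have "component x \<xi> = 0" for \<xi>
      using inj component_in by blast
    then show "x = 0" using sum_component[of x] by simp
  qed
  have "inj \<psi>"
  proof (rule injI)
    fix x y assume "\<psi> x = \<psi> y"
    then show "x = y" using inj_0[of "x - y"] by (simp add: lin.diff)
  qed
  then show ?thesis
    unfolding graded_embeds_def graded_hom_def algebra_hom_def
    using lin \<psi>_mult \<psi>_hom f by (intro exI[of _ \<psi>]) auto
qed

end

section \<open>Division graded algebras\<close>

context assoc_algebra
begin

text \<open>Horner evaluation at \<open>z\<close>, where a constant \<open>a\<close> enters as
  \<open>a *s u\<close>: \<open>u\<close> is meant to be the unit, for which the type has no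
  constant.\<close>

definition poly_value :: "'a \<Rightarrow> 'a \<Rightarrow> 'f poly \<Rightarrow> 'a" where
  "poly_value u z p = fold_coeffs (\<lambda>a y. a *s u + z * y) p 0"

lemma poly_value_0 [simp]: "poly_value u z 0 = 0"
  by (simp add: poly_value_def)

lemma poly_value_pCons [simp]: "poly_value u z (pCons a p) = a *s u + z * poly_value u z p"
  by (cases "a = 0 \<and> p = 0") (auto simp: poly_value_def)

lemma poly_value_add: "poly_value u z (p + q) = poly_value u z p + poly_value u z q"
  by (induction p q rule: poly_induct2) (auto simp: algebra_simps scale_left_distrib)

lemma poly_value_smult: "poly_value u z (smult c p) = c *s poly_value u z p"
  by (induction p) (auto simp: scale_right_distrib scale_mult_right)

lemma poly_value_sum: "poly_value u z (\<Sum>i\<in>I. h i) = (\<Sum>i\<in>I. poly_value u z (h i))"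
  by (induction I rule: infinite_finite_induct) (auto simp: poly_value_add)

text \<open>Otherwise evaluation is injective, and the values of the monomials, that is
  \<open>u\<close>, \<open>z * u\<close>, \<open>z * (z * u)\<close> and so on, form an infinite
  independent family.\<close>

lemma annihilating_poly:
  assumes "finite_dimensional scale"
  obtains p where "p \<noteq> 0" "poly_value u z p = 0"
proof (rule ccontr)
  assume "\<not> thesis"
  then have inj: "poly_value u z p = 0 \<Longrightarrow> p = 0" for p using that by blast
  obtain Basis where "finite_dimensional_vector_space scale Basis"
    using assms unfolding finite_dimensional_def by blast
  then interpret finite_dimensional_vector_space scale Basis .
  let ?v = "\<lambda>i. poly_value u z (monom 1 i)"
  have inj_v: "inj ?v"
  proof (rule injI)
    fix i j assume "?v i = ?v j"
    then have "poly_value u z (monom 1 i + smult (- 1) (monom 1 j)) = 0"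
      by (simp only: poly_value_add poly_value_smult) simp
    then have "monom (1::'f) i = monom 1 j" using inj by fastforce
    then show "i = j" by (simp add: monom_eq_iff')
  qed
  have "independent (range ?v)"
    unfolding independent_explicit_module
  proof (intro allI impI)
    fix t w y assume t: "finite t" "t \<subseteq> range ?v" and 0: "(\<Sum>v\<in>t. w v *s v) = 0" and y: "y \<in> t"
    \<comment> \<open>Indexing by exponents turns a linear relation into a polynomial of value 0,
      whose coefficients are the weights.\<close>
    obtain I where I: "t = ?v ` I" using t(2) by (meson subset_imageE)
    have inj_I: "inj_on ?v I" using inj_v inj_on_subset by blast
    have finI: "finite I" using t(1) I inj_I finite_imageD by blast
    have "poly_value u z (\<Sum>i\<in>I. smult (w (?v i)) (monom 1 i)) = 0"
      using 0 by (simp add: poly_value_sum poly_value_smult I sum.reindex[OF inj_I])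
    then have "(\<Sum>i\<in>I. smult (w (?v i)) (monom 1 i)) = 0" by (rule inj)
    moreover obtain i where "i \<in> I" "y = ?v i" using I y by blast
    ultimately have "coeff (\<Sum>i\<in>I. smult (w (?v i)) (monom 1 i)) i = 0" by simp
    then show "w y = 0"
      using finI \<open>i \<in> I\<close> \<open>y = ?v i\<close> by (simp add: coeff_sum smult_monom if_distrib cong: if_cong)
  qed
  then have "finite (range ?v)" by (rule finiteI_independent)
  then show False using inj_v finite_imageD by blast
qed

end

text \<open>The scalar \<open>c\<close> is an eigenvalue of \<open>z\<close>. If every shift had a
  left inverse, the linear factors of an annihilating polynomial could be cancelled one by one, down
  to a constant, which must be 0 because \<open>u \<noteq> 0\<close>.\<close>

lemma singular_shift_exists:
  fixes scale :: "'f::alg_closed_field \<Rightarrow> 'a::ring \<Rightarrow> 'a"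
  assumes "assoc_algebra scale" "finite_dimensional scale"
    and u: "\<And>x. u * x = x" "u \<noteq> 0"
  obtains c where "\<And>y. y * (z - scale c u) \<noteq> u"
proof (rule ccontr)
  interpret assoc_algebra scale by fact
  assume "\<not> thesis"
  then have inv: "\<exists>y. y * (z - scale c u) = u" for c using that by blast
  have "p = 0" if "poly_value u z p = 0" for p
    using that
  proof (induction "degree p" arbitrary: p rule: less_induct)
    case less
    show ?case
    proof (cases "degree p = 0")
      case True
      then obtain a where "p = [:a:]" by (rule degree_eq_zeroE)
      then show ?thesis using less.prems u by simp
    next
      case False
      then obtain c where "poly p c = 0" using alg_closed_imp_poly_has_root by blast
      then obtain q where q: "p = [:- c, 1:] * q" by (auto simp: poly_eq_0_iff_dvd)
      \<comment> \<open>This left inverse cancels the linear factor, leaving an annihilating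
        polynomial of smaller degree.\<close>
      obtain y where y: "y * (z - scale c u) = u" using inv by blast
      have "p = smult (- c) q + pCons 0 q" by (simp add: q)
      then have "poly_value u z p = (z - scale c u) * poly_value u z q"
        by (simp only: poly_value_add poly_value_smult poly_value_pCons)
           (simp add: left_diff_distrib scale_mult_left u)
      then have "u * poly_value u z q = y * poly_value u z p"
        using y by (metis mult.assoc)
      then have "poly_value u z q = 0" using less.prems u by simp
      moreover have "degree q < degree p"
      proof -
        have "q \<noteq> 0" using False q by auto
        then have "degree p = degree [:- c, 1:] + degree q"
          unfolding q by (intro degree_mult_eq) simp_all
        then show ?thesis by simp
      qed
      ultimately have "q = 0" using less.hyps by blast
      then show ?thesis using q by simp
    qed
  qed
  then show False using annihilating_poly[OF assms(2)] by metis
qed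

text \<open>Let \<open>x'\<close> be the inverse of \<open>x\<close> and \<open>c\<close> an
  eigenvalue of \<open>x' * y\<close>. Then \<open>y - scale c x\<close> is homogeneous, and an
  inverse of it would yield a left inverse of \<open>x' * y - scale c u\<close>; hence it is
  0.\<close>

lemma division_graded_component_span:
  fixes scale :: "'f::alg_closed_field \<Rightarrow> 'a::ring \<Rightarrow> 'a"
  assumes A: "division_graded_algebra scale A" "finite_dimensional scale"
    and x: "x \<in> A \<xi>" "x \<noteq> 0" and y: "y \<in> A \<xi>"
  obtains c where "y = scale c x"
proof -
  interpret division_graded_algebra scale A by fact
  obtain u where u: "\<And>x. u * x = x" "\<And>x. x * u = x"
    and inv: "\<And>\<xi> x. x \<in> A \<xi> \<Longrightarrow> x \<noteq> 0 \<Longrightarrow> \<exists>y. x * y = u \<and> y * x = u"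
    using unitary_division by blast
  obtain x' where x': "x * x' = u" "x' * x = u" using inv x by blast
  have "u \<noteq> 0" using x u(1)[of x] by auto
  obtain c where c: "\<And>w. w * (x' * y - scale c u) \<noteq> u"
    using singular_shift_exists[OF assoc_algebra_axioms A(2) u(1) \<open>u \<noteq> 0\<close>] by blast
  have "y - scale c x = 0"
  proof (rule ccontr)
    assume "y - scale c x \<noteq> 0"
    moreover have "y - scale c x \<in> A \<xi>"
      using x y subspace_component subspace_diff subspace_scale by blast
    ultimately obtain w where w: "w * (y - scale c x) = u" using inv by blast
    have "x' * y - scale c u = x' * (y - scale c x)"
      by (simp add: right_diff_distrib scale_mult_right x')
    then have "(w * x) * (x' * y - scale c u) = w * ((x * x') * (y - scale c x))"
      by (simp only: mult.assoc)
    then show False using c w x' u by simp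
  qed
  then have "y = scale c x" by simp
  then show ?thesis by (rule that)
qed

section \<open>Monomials in homogeneous elements and identities between them\<close>

context division_graded_algebra
begin

lemma homogeneous_mult_nonzero:
  assumes "x \<in> A \<xi>" "x \<noteq> 0" "y \<noteq> 0"
  shows "x * y \<noteq> 0"
proof
  assume "x * y = 0"
  obtain u x' where "\<And>z. u * z = z" "x' * x = u"
    using unitary_division assms by meson
  then have "y = x' * (x * y)" by (simp flip: mult.assoc)
  then show False using \<open>x * y = 0\<close> assms by simp
qed

lemma eval_letters_nonzero:
  assumes "ws \<noteq> []" "\<And>g. g \<in> set ws \<Longrightarrow> x g \<in> A g \<and> x g \<noteq> 0"
  shows "eval_letters x ws \<noteq> 0"
  using assms
proof (induction ws rule: induct_list012)
  case (3 g h ws)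
  then show ?case using homogeneous_mult_nonzero[of "x g" g] by simp
qed auto

end

lemma eval_letters_map: "eval_letters \<sigma> (map h ws) = eval_letters (\<lambda>v. \<sigma> (h v)) ws"
  by (induction ws rule: induct_list012) auto

text \<open>Scalars move out of every factor. As they commute, their product depends only on the
  multiset of letters.\<close>

lemma (in assoc_algebra) eval_letters_rescale:
  assumes "\<And>v. v \<in> set ws \<Longrightarrow> \<sigma> v = c v *s \<tau> v"
  shows "eval_letters \<sigma> ws = prod_list (map c ws) *s eval_letters \<tau> ws"
  using assms
  by (induction ws rule: induct_list012) (auto simp: scale_mult_left scale_mult_right ac_simps)

text \<open>
  The components are one-dimensional, so a substitution rescales the monomials \<open>x\<close>, and two words
  with the same letters are rescaled by the same factor.
\<close>

lemma binomial_identity: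
  fixes scale :: "'f::alg_closed_field \<Rightarrow> 'a::ring \<Rightarrow> 'a" and A :: "'g::group_add \<Rightarrow> 'a set"
  assumes A: "division_graded_algebra scale A" "finite_dimensional scale"
    and x: "\<And>g. g \<in> set ws \<Longrightarrow> x g \<in> A g \<and> x g \<noteq> 0"
    and ws: "ws \<noteq> []" "mset ws = mset ws'"
    and s: "eval_letters x ws = scale s (eval_letters x ws')"
  shows "Poly_Mapping.single (Word (map (Pair 0) ws)) 1
       + Poly_Mapping.single (Word (map (Pair 0) ws')) (- s) \<in> graded_identities scale A"
    (is "?f \<in> _")
proof -
  interpret division_graded_algebra scale A by fact
  have "ws' \<noteq> []" using ws by auto
  have "?f \<in> free_algebra"
    using ws(1) \<open>ws' \<noteq> []\<close>
    by (auto simp: free_algebra_def lookup_add lookup_single when_def zero_free_word_def)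
  moreover have "evaluation scale \<sigma> ?f = 0" if \<sigma>: "\<And>i \<xi>. \<sigma> (i, \<xi>) \<in> A \<xi>" for \<sigma>
  proof -
    \<comment> \<open>Each degree contributes the single variable of index 0, so all occurrences of
      a letter, in both words, get the same scalar.\<close>
    have "\<exists>k. \<sigma> (0, g) = scale k (x g)" if "g \<in> set ws" for g
      using division_graded_component_span[OF A, of "x g" g] x[OF that] \<sigma> by metis
    then obtain k where k: "\<And>g. g \<in> set ws \<Longrightarrow> \<sigma> (0, g) = scale (k g) (x g)" by metis
    have "prod_list (map k ws) = prod_list (map k ws')"
      by (metis mset_map prod_mset_prod_list ws(2))
    moreover have "set ws' = set ws" using ws(2) by (metis set_mset_mset)
    ultimately show ?thesis
      using eval_letters_rescale[of ws "\<lambda>g. \<sigma> (0, g)" k x]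
        eval_letters_rescale[of ws' "\<lambda>g. \<sigma> (0, g)" k x] k s
      by (simp add: eval_add eval_single eval_letters_map ac_simps)
  qed
  ultimately show ?thesis
    unfolding graded_identities_def by blast
qed

text \<open>If \<open>A g\<close> were zero, a variable of degree \<open>g\<close> would by itself
  be an identity of \<open>A\<close>, hence of \<open>B\<close>; substituting \<open>y\<close>
  refutes this.\<close>

lemma identities_subset_component_nonzero:
  fixes scaleA :: "'f::field \<Rightarrow> 'a::ring \<Rightarrow> 'a" and scaleB :: "'f \<Rightarrow> 'b::ring \<Rightarrow> 'b"
    and A :: "'g::group_add \<Rightarrow> 'a set" and B :: "'g \<Rightarrow> 'b set"
  assumes "graded_algebra scaleA A" "graded_algebra scaleB B"
    and "graded_identities scaleA A \<subseteq> graded_identities scaleB B"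
    and y: "y \<in> B g" "y \<noteq> 0"
  obtains x where "x \<in> A g" "x \<noteq> 0"
proof (rule ccontr)
  interpret A: graded_algebra scaleA A by fact
  interpret B: graded_algebra scaleB B by fact
  let ?X = "Poly_Mapping.single (Word [(0::nat, g)]) (1::'f)"
  assume "\<not> thesis"
  then have "x \<in> A g \<Longrightarrow> x = 0" for x using that by blast
  then have "?X \<in> graded_identities scaleA A"
    by (auto simp: graded_identities_def free_algebra_def lookup_single when_def
        zero_free_word_def A.eval_var)
  then have "?X \<in> graded_identities scaleB B" using assms(3) by blast
  moreover define \<sigma> where "\<sigma> v = (if v = (0, g) then y else 0)" for v :: "nat \<times> 'g"
  have "\<sigma> (i, \<xi>) \<in> B \<xi>" for i \<xi>
    unfolding \<sigma>_def using y B.subspace_component B.subspace_0 by auto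
  ultimately have "evaluation scaleB \<sigma> ?X = 0"
    unfolding graded_identities_def by blast
  then show False using y by (simp add: B.eval_var \<sigma>_def)
qed

section \<open>Embeddings\<close>

text \<open>The map sends \<open>y \<xi>\<close> to \<open>x \<xi>\<close> in each degree. Both
  families run over the whole group and are 0 off the support. Where
  \<open>y (\<xi> + \<zeta>) = 0\<close>, the constant \<open>c\<close> is not unique, but then
  \<open>x (\<xi> + \<zeta>) = 0\<close> as well.\<close>

lemma embeds_of_structure_constants:
  fixes scaleA :: "'f::field \<Rightarrow> 'a::ring \<Rightarrow> 'a" and scaleB :: "'f \<Rightarrow> 'b::ring \<Rightarrow> 'b"
    and A :: "'g::group_add \<Rightarrow> 'a set" and B :: "'g \<Rightarrow> 'b set"
  assumes A: "graded_algebra scaleA A" and B: "graded_algebra scaleB B"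
    and x: "\<And>\<xi>. x \<xi> \<in> A \<xi>" and y: "\<And>\<xi>. y \<xi> \<in> B \<xi>"
    and span: "\<And>\<xi> b. b \<in> B \<xi> \<Longrightarrow> \<exists>k. b = scaleB k (y \<xi>)"
    and zero: "\<And>\<xi>. x \<xi> = 0 \<longleftrightarrow> y \<xi> = 0"
    and mult: "\<And>\<xi> \<zeta> c. y \<xi> * y \<zeta> = scaleB c (y (\<xi> + \<zeta>)) \<Longrightarrow> x \<xi> * x \<zeta> = scaleA c (x (\<xi> + \<zeta>))"
  shows "graded_embeds scaleB B scaleA A"
proof -
  interpret A: graded_algebra scaleA A by fact
  interpret B: graded_algebra scaleB B by fact
  \<comment> \<open>The chosen coordinate is unique if \<open>y \<xi> \<noteq> 0\<close>; otherwise
    \<open>x \<xi> = 0\<close> and any choice gives 0.\<close>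
  define f where "f \<xi> b = scaleA (SOME k. b = scaleB k (y \<xi>)) (x \<xi>)" for \<xi> b
  have f: "f \<xi> (scaleB k (y \<xi>)) = scaleA k (x \<xi>)" for \<xi> k
  proof (cases "y \<xi> = 0")
    case True
    then have "x \<xi> = 0" using zero by simp
    then show ?thesis by (simp add: f_def)
  next
    case False
    then have "(SOME l. scaleB k (y \<xi>) = scaleB l (y \<xi>)) = k" by (intro some_equality) auto
    then show ?thesis by (simp add: f_def)
  qed
  show ?thesis
  proof (rule B.graded_linear_extension[OF A, of f])
    show "f \<xi> b \<in> A \<xi>" for \<xi> b
      unfolding f_def using A.subspace_component A.subspace_scale x by blast
  next
    fix \<xi> b b' assume "b \<in> B \<xi>" "b' \<in> B \<xi>"
    then obtain k l where "b = scaleB k (y \<xi>)" "b' = scaleB l (y \<xi>)" using span by meson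
    then show "f \<xi> (b + b') = f \<xi> b + f \<xi> b'"
      by (simp add: f A.scale_left_distrib flip: B.scale_left_distrib)
  next
    fix \<xi> b c assume "b \<in> B \<xi>"
    then obtain k where "b = scaleB k (y \<xi>)" using span by meson
    then show "f \<xi> (scaleB c b) = scaleA c (f \<xi> b)" by (simp add: f)
  next
    fix \<xi> \<zeta> b b' assume "b \<in> B \<xi>" "b' \<in> B \<zeta>"
    then obtain k l where kl: "b = scaleB k (y \<xi>)" "b' = scaleB l (y \<zeta>)" using span by meson
    obtain c where c: "y \<xi> * y \<zeta> = scaleB c (y (\<xi> + \<zeta>))"
      using span B.mult_component y by meson
    have "b * b' = scaleB (k * l * c) (y (\<xi> + \<zeta>))"
      by (simp add: kl B.scale_mult_left B.scale_mult_right c ac_simps)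
    then show "f (\<xi> + \<zeta>) (b * b') = f \<xi> b * f \<zeta> b'"
      by (simp add: f kl A.scale_mult_left A.scale_mult_right mult[OF c] ac_simps)
  next
    fix \<xi> b assume b: "b \<in> B \<xi>" "f \<xi> b = 0"
    then obtain k where "b = scaleB k (y \<xi>)" using span by meson
    then show "b = 0" using b(2) zero by (auto simp: f)
  qed
qed

text \<open>The exponent vector of a word, its image in the free abelian group on the letters.
  Integer values permit differences.\<close>

definition content :: "'g list \<Rightarrow> ('g \<Rightarrow>\<^sub>0 int)" where
  "content ws = (\<Sum>g\<leftarrow>ws. Poly_Mapping.single g 1)"

lemma content_append: "content (ws @ ws') = content ws + content ws'"
  by (simp add: content_def)

lemma lookup_content: "Poly_Mapping.lookup (content ws) g = int (count (mset ws) g)"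
  by (induction ws) (auto simp: content_def lookup_add lookup_single when_def)

lemma mset_eq_if_content_eq: "content ws = content ws' \<Longrightarrow> mset ws = mset ws'"
  by (metis lookup_content multiset_eqI of_nat_eq_iff)

text \<open>
  Whenever \<open>x(w) = s x(w')\<close> and \<open>y(w) = t y(w')\<close>, the exponent vector of \<open>w / w'\<close> is sent to
  \<open>t / s\<close>. This is well defined because the binomial identities of \<open>A\<close> hold in \<open>B\<close>.
\<close>

lemma rescaling_exists:
  fixes scaleA :: "'f::alg_closed_field \<Rightarrow> 'a::ring \<Rightarrow> 'a" and scaleB :: "'f \<Rightarrow> 'b::ring \<Rightarrow> 'b"
    and A :: "'g::group_add \<Rightarrow> 'a set" and B :: "'g \<Rightarrow> 'b set"
  assumes A: "division_graded_algebra scaleA A" "finite_dimensional scaleA"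
    and B: "division_graded_algebra scaleB B"
    and ids: "graded_identities scaleA A \<subseteq> graded_identities scaleB B"
    and x: "\<And>g. g \<in> K \<Longrightarrow> x g \<in> A g \<and> x g \<noteq> 0"
    and y: "\<And>g. g \<in> K \<Longrightarrow> y g \<in> B g \<and> y g \<noteq> 0"
  obtains \<mu> where "\<And>g. \<mu> g \<noteq> 0"
    "\<And>g h s t. g \<in> K \<Longrightarrow> h \<in> K \<Longrightarrow> g + h \<in> K \<Longrightarrow> x g * x h = scaleA s (x (g + h)) \<Longrightarrow>
       y g * y h = scaleB t (y (g + h)) \<Longrightarrow> \<mu> g * \<mu> h * s = t * \<mu> (g + h)"
proof (cases "K = {}")
  \<comment> \<open>Treated apart, since for empty \<open>K\<close> the set \<open>P\<close> below
    would lack the pair (0, 1).\<close>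
  case True
  then show ?thesis using that[of "\<lambda>_. 1"] by simp
next
  case False
  interpret A: division_graded_algebra scaleA A by fact
  interpret B: division_graded_algebra scaleB B by fact
  \<comment> \<open>The same two words are proportional in both algebras. Nonzero factors make the
    relation symmetric, and concatenation multiplies them.\<close>
  define R where "R ws ws' s t \<longleftrightarrow> ws \<noteq> [] \<and> ws' \<noteq> [] \<and> set ws \<subseteq> K \<and> set ws' \<subseteq> K \<and>
    s \<noteq> 0 \<and> t \<noteq> 0 \<and> eval_letters x ws = scaleA s (eval_letters x ws') \<and>
    eval_letters y ws = scaleB t (eval_letters y ws')" for ws ws' s t
  define P where "P = {(content ws - content ws', t / s) | ws ws' s t. R ws ws' s t}"
  have R_append: "R (ws1 @ ws2) (ws1' @ ws2') (s1 * s2) (t1 * t2)"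
    if "R ws1 ws1' s1 t1" "R ws2 ws2' s2 t2" for ws1 ws1' s1 t1 ws2 ws2' s2 t2
    using that unfolding R_def
    by (simp add: eval_letters_append A.scale_mult_left A.scale_mult_right
        B.scale_mult_left B.scale_mult_right ac_simps)
  have R_sym: "R ws' ws (1 / s) (1 / t)" if "R ws ws' s t" for ws ws' s t
    using that unfolding R_def by simp
  have "s = t" if R: "R ws ws' s t" and eq: "mset ws = mset ws'" for ws ws' s t
  proof -
    have "Poly_Mapping.single (Word (map (Pair 0) ws)) 1
        + Poly_Mapping.single (Word (map (Pair 0) ws')) (- s) \<in> graded_identities scaleA A"
      using R eq x unfolding R_def by (intro binomial_identity[OF A, where x = x]) auto
    then have id: "Poly_Mapping.single (Word (map (Pair 0) ws)) 1
        + Poly_Mapping.single (Word (map (Pair 0) ws')) (- s) \<in> graded_identities scaleB B"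
      using ids by blast
    \<comment> \<open>Extending \<open>y\<close> by 0 outside \<open>K\<close> gives an admissible
      substitution.\<close>
    define \<sigma> where "\<sigma> v = (if snd v \<in> K then y (snd v) else 0)" for v :: "nat \<times> 'g"
    have \<sigma>0: "\<sigma> (0, g) = y g" if "g \<in> K" for g
      using that by (simp add: \<sigma>_def)
    have "\<sigma> (i, \<xi>) \<in> B \<xi>" for i \<xi>
      unfolding \<sigma>_def using y B.subspace_component B.subspace_0 by auto
    then have "evaluation scaleB \<sigma> (Poly_Mapping.single (Word (map (Pair 0) ws)) 1
        + Poly_Mapping.single (Word (map (Pair 0) ws')) (- s)) = 0"
      using id unfolding graded_identities_def by blast
    then have "eval_letters (\<lambda>g. \<sigma> (0, g)) ws = scaleB s (eval_letters (\<lambda>g. \<sigma> (0, g)) ws')"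
      by (simp add: B.eval_add B.eval_single eval_letters_map)
    moreover have "eval_letters (\<lambda>g. \<sigma> (0, g)) vs = eval_letters y vs" if "set vs \<subseteq> K" for vs
      using B.eval_letters_rescale[of vs "\<lambda>g. \<sigma> (0, g)" "\<lambda>_. 1" y] that \<sigma>0
      by (simp add: subset_iff map_replicate_const)
    ultimately have "scaleB t (eval_letters y ws') = scaleB s (eval_letters y ws')"
      using R unfolding R_def by simp
    \<comment> \<open>A nonzero monomial can be cancelled, which leaves
      \<open>s = t\<close>.\<close>
    moreover have "eval_letters y ws' \<noteq> 0"
      using R y unfolding R_def by (intro B.eval_letters_nonzero) auto
    ultimately show ?thesis by simp
  qed
  note R_perm = this
  have "partial_character P"
    unfolding partial_character_def
  proof (intro conjI allI impI)
    obtain g where "g \<in> K" using False by blast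
    then have "R [g] [g] 1 1" unfolding R_def by simp
    then have "(content [g] - content [g], 1 / 1) \<in> P" unfolding P_def by blast
    then show "(0, 1) \<in> P" by simp
  next
    fix c assume "(0, c) \<in> P"
    then obtain ws ws' s t where "content ws = content ws'" "c = t / s" and R: "R ws ws' s t"
      unfolding P_def by auto
    then have "s = t" using R_perm mset_eq_if_content_eq by blast
    then show "c = 1" using R \<open>c = t / s\<close> unfolding R_def by simp
  next
    fix v c assume "(v, c) \<in> P"
    then show "c \<noteq> 0" unfolding P_def R_def by auto
  next
    fix v c w d assume "(v, c) \<in> P" "(w, d) \<in> P"
    then obtain ws1 ws1' s1 t1 ws2 ws2' s2 t2 where
      1: "v = content ws1 - content ws1'" "c = t1 / s1" "R ws1 ws1' s1 t1" and
      2: "w = content ws2 - content ws2'" "d = t2 / s2" "R ws2 ws2' s2 t2"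
      unfolding P_def by blast
    \<comment> \<open>Reversing the second relation before concatenating produces differences of
      contents and quotients of values.\<close>
    have "R (ws1 @ ws2') (ws1' @ ws2) (s1 * (1 / s2)) (t1 * (1 / t2))"
      using R_append[OF 1(3) R_sym[OF 2(3)]] .
    moreover have "v - w = content (ws1 @ ws2') - content (ws1' @ ws2)"
      by (simp add: 1(1) 2(1) content_append)
    moreover have "c / d = (t1 * (1 / t2)) / (s1 * (1 / s2))"
      by (simp add: 1(2) 2(2))
    ultimately show "(v - w, c / d) \<in> P" unfolding P_def by blast
  qed
  then obtain \<chi> where \<chi>: "\<And>v. \<chi> v \<noteq> 0" "\<And>v w. \<chi> (v + w) = \<chi> v * \<chi> w"
    "\<And>v w. \<chi> (v - w) = \<chi> v / \<chi> w" "\<And>v c. (v, c) \<in> P \<Longrightarrow> \<chi> v = c"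
    by (rule character_extension) blast
  show ?thesis
  \<comment> \<open>The rescaling factors are the values of the character on the free
    generators.\<close>
  proof (rule that[of "\<lambda>g. \<chi> (Poly_Mapping.single g 1)"])
    show "\<chi> (Poly_Mapping.single g 1) \<noteq> 0" for g by (rule \<chi>(1))
  next
    fix g h s t
    assume K: "g \<in> K" "h \<in> K" "g + h \<in> K"
      and s: "x g * x h = scaleA s (x (g + h))" and t: "y g * y h = scaleB t (y (g + h))"
    have "x g * x h \<noteq> 0" using K x A.homogeneous_mult_nonzero by blast
    then have "s \<noteq> 0" using s by auto
    have "y g * y h \<noteq> 0" using K y B.homogeneous_mult_nonzero by blast
    then have "t \<noteq> 0" using t by auto
    \<comment> \<open>The multiplication rule is itself a relation, between a two-letter and a
      one-letter word.\<close>
    have "R [g, h] [g + h] s t"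
      unfolding R_def using K s t \<open>s \<noteq> 0\<close> \<open>t \<noteq> 0\<close> by simp
    then have "\<chi> (content [g, h] - content [g + h]) = t / s"
      by (intro \<chi>(4)) (auto simp: P_def)
    then have "\<chi> (Poly_Mapping.single g 1) * \<chi> (Poly_Mapping.single h 1) /
        \<chi> (Poly_Mapping.single (g + h) 1) = t / s"
      by (simp add: \<chi>(2,3) content_def)
    then show "\<chi> (Poly_Mapping.single g 1) * \<chi> (Poly_Mapping.single h 1) * s =
        t * \<chi> (Poly_Mapping.single (g + h) 1)"
      using \<chi>(1) \<open>s \<noteq> 0\<close> by (simp add: field_simps)
  qed
qed

text \<open>With \<open>K\<close> the support of \<open>B\<close>, choose spanning vectors
  \<open>x\<close> and \<open>y\<close> on \<open>K\<close>. After rescaling \<open>x\<close> by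
  \<open>\<mu>\<close> the structure constants of \<open>y\<close> hold for it too.\<close>

lemma identities_subset_imp_embeds:
  fixes scaleA :: "'f::alg_closed_field \<Rightarrow> 'a::ring \<Rightarrow> 'a" and scaleB :: "'f \<Rightarrow> 'b::ring \<Rightarrow> 'b"
    and A :: "'g::group_add \<Rightarrow> 'a set" and B :: "'g \<Rightarrow> 'b set"
  assumes A: "division_graded_algebra scaleA A" "finite_dimensional scaleA"
    and B: "division_graded_algebra scaleB B" "finite_dimensional scaleB"
    and ids: "graded_identities scaleA A \<subseteq> graded_identities scaleB B"
  shows "graded_embeds scaleB B scaleA A"
proof -
  interpret A: division_graded_algebra scaleA A by fact
  interpret B: division_graded_algebra scaleB B by fact
  have A0: "0 \<in> A \<xi>" and B0: "0 \<in> B \<xi>" for \<xi>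
    using A.subspace_component A.subspace_0 B.subspace_component B.subspace_0 by auto
  define K where "K = {\<xi>. \<exists>b\<in>B \<xi>. b \<noteq> 0}"
  have "\<exists>b. b \<in> B \<xi> \<and> (b = 0 \<longleftrightarrow> \<xi> \<notin> K)" for \<xi>
    using B0 unfolding K_def by blast
  then obtain y where y: "\<And>\<xi>. y \<xi> \<in> B \<xi>" "\<And>\<xi>. y \<xi> = 0 \<longleftrightarrow> \<xi> \<notin> K" by metis
  have "\<exists>a. a \<in> A \<xi> \<and> (a = 0 \<longleftrightarrow> \<xi> \<notin> K)" for \<xi>
  proof (cases "\<xi> \<in> K")
    case True
    then obtain a where "a \<in> A \<xi>" "a \<noteq> 0"
      using identities_subset_component_nonzero[OF A.graded_algebra_axioms B.graded_algebra_axioms ids]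
        y by metis
    then show ?thesis using True by blast
  qed (use A0 in blast)
  then obtain x where x: "\<And>\<xi>. x \<xi> \<in> A \<xi>" "\<And>\<xi>. x \<xi> = 0 \<longleftrightarrow> \<xi> \<notin> K" by metis
  obtain \<mu> where \<mu>0: "\<And>g. \<mu> g \<noteq> 0"
    and \<mu>: "\<And>g h s t. g \<in> K \<Longrightarrow> h \<in> K \<Longrightarrow> g + h \<in> K \<Longrightarrow> x g * x h = scaleA s (x (g + h)) \<Longrightarrow>
       y g * y h = scaleB t (y (g + h)) \<Longrightarrow> \<mu> g * \<mu> h * s = t * \<mu> (g + h)"
    using rescaling_exists[OF A B(1) ids, of K x y] x y by metis
  show ?thesis
  proof (rule embeds_of_structure_constants[OF A.graded_algebra_axioms B.graded_algebra_axioms])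
    show "scaleA (\<mu> \<xi>) (x \<xi>) \<in> A \<xi>" for \<xi>
      using x A.subspace_component A.subspace_scale by blast
    show "y \<xi> \<in> B \<xi>" for \<xi> by (rule y)
    show "\<exists>k. b = scaleB k (y \<xi>)" if "b \<in> B \<xi>" for \<xi> b
    proof (cases "\<xi> \<in> K")
      case True
      then show ?thesis
        using division_graded_component_span[OF B, of "y \<xi>" \<xi> b] y that by metis
    next
      case False
      then have "b = 0" using that unfolding K_def by blast
      then show ?thesis by (metis B.scale_zero_left)
    qed
    show "scaleA (\<mu> \<xi>) (x \<xi>) = 0 \<longleftrightarrow> y \<xi> = 0" for \<xi>
      using \<mu>0 x y by simp
  next
    fix \<xi> \<zeta> c assume c: "y \<xi> * y \<zeta> = scaleB c (y (\<xi> + \<zeta>))"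
    show "scaleA (\<mu> \<xi>) (x \<xi>) * scaleA (\<mu> \<zeta>) (x \<zeta>) = scaleA c (scaleA (\<mu> (\<xi> + \<zeta>)) (x (\<xi> + \<zeta>)))"
    proof (cases "\<xi> \<in> K \<and> \<zeta> \<in> K")
      case True
      then have "y \<xi> * y \<zeta> \<noteq> 0" using y B.homogeneous_mult_nonzero by metis
      \<comment> \<open>The support is closed under the group operation because the product of
        homogeneous nonzero elements is nonzero.\<close>
      then have K: "\<xi> + \<zeta> \<in> K" using c y(2) by auto
      obtain s where s: "x \<xi> * x \<zeta> = scaleA s (x (\<xi> + \<zeta>))"
        using division_graded_component_span[OF A, of "x (\<xi> + \<zeta>)" "\<xi> + \<zeta>"]
          A.mult_component x K by metis
      have "\<mu> \<xi> * \<mu> \<zeta> * s = c * \<mu> (\<xi> + \<zeta>)" using \<mu> True K s c by blast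
      then show ?thesis
        by (simp add: A.scale_mult_left A.scale_mult_right s ac_simps)
    next
      case False
      then have "x \<xi> = 0 \<and> y \<xi> = 0 \<or> x \<zeta> = 0 \<and> y \<zeta> = 0" using x y by simp
      moreover from this have "y \<xi> * y \<zeta> = 0" by auto
      then have "c = 0 \<or> x (\<xi> + \<zeta>) = 0" using c x(2) y(2) by simp
      ultimately show ?thesis by auto
    qed
  qed
qed

section \<open>Homomorphisms and the transfer of identities\<close>

lemma algebra_hom_zero:
  assumes "algebra_hom scaleA scaleB \<psi>"
  shows "\<psi> 0 = 0"
proof -
  interpret Vector_Spaces.linear scaleA scaleB \<psi> using assms unfolding algebra_hom_def by blast
  show ?thesis by (rule zero)
qed

lemma hom_evaluation:
  assumes "assoc_algebra scaleA" "assoc_algebra scaleB" and \<psi>: "algebra_hom scaleA scaleB \<psi>"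
  shows "\<psi> (evaluation scaleA \<sigma> f) = evaluation scaleB (\<lambda>v. \<psi> (\<sigma> v)) f"
proof -
  interpret Vector_Spaces.linear scaleA scaleB \<psi> using \<psi> unfolding algebra_hom_def by blast
  have "\<psi> (eval_letters \<sigma> ws) = eval_letters (\<lambda>v. \<psi> (\<sigma> v)) ws" for ws
    using \<psi> zero unfolding algebra_hom_def
    by (induction ws rule: induct_list012) auto
  then show ?thesis by (simp add: evaluation_def sum scale)
qed

text \<open>A substitution into \<open>B\<close> becomes one into \<open>A\<close> after composing
  with \<open>\<psi>\<close>, and injectivity carries the vanishing back.\<close>

lemma embeds_imp_identities_subset:
  assumes A: "graded_algebra scaleA A" and B: "graded_algebra scaleB B"
    and "graded_embeds scaleB B scaleA A"
  shows "graded_identities scaleA A \<subseteq> graded_identities scaleB B"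
proof -
  interpret A: graded_algebra scaleA A by fact
  interpret B: graded_algebra scaleB B by fact
  obtain \<psi> where \<psi>: "algebra_hom scaleB scaleA \<psi>" "\<And>\<xi>. \<psi> ` B \<xi> \<subseteq> A \<xi>" "inj \<psi>"
    using assms(3) unfolding graded_embeds_def graded_hom_def by blast
  have "\<psi> 0 = 0" using \<psi>(1) by (rule algebra_hom_zero)
  show ?thesis
  proof
    fix f assume f: "f \<in> graded_identities scaleA A"
    have "evaluation scaleB \<sigma> f = 0" if \<sigma>: "\<And>i \<xi>. \<sigma> (i, \<xi>) \<in> B \<xi>" for \<sigma>
    proof -
      have "\<psi> (\<sigma> (i, \<xi>)) \<in> A \<xi>" for i \<xi> using \<psi>(2) \<sigma> by blast
      then have "evaluation scaleA (\<lambda>v. \<psi> (\<sigma> v)) f = 0"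
        using f by (simp add: graded_identities_def)
      then have "\<psi> (evaluation scaleB \<sigma> f) = \<psi> 0"
        using hom_evaluation[OF B.assoc_algebra_axioms A.assoc_algebra_axioms \<psi>(1)] \<open>\<psi> 0 = 0\<close>
        by metis
      then show ?thesis using \<psi>(3) by (simp add: inj_eq)
    qed
    then show "f \<in> graded_identities scaleB B"
      using f unfolding graded_identities_def by blast
  qed
qed

text \<open>Each nonzero component of \<open>B\<close> is a line and contains a nonzero image, hence
  is covered; summing components gives surjectivity.\<close>

lemma embeds_imp_isomorphic:
  fixes scaleA :: "'f::alg_closed_field \<Rightarrow> 'a::ring \<Rightarrow> 'a" and scaleB :: "'f \<Rightarrow> 'b::ring \<Rightarrow> 'b"
    and A :: "'g::group_add \<Rightarrow> 'a set" and B :: "'g \<Rightarrow> 'b set"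
  assumes A: "graded_algebra scaleA A"
    and B: "division_graded_algebra scaleB B" "finite_dimensional scaleB"
    and embeds: "graded_embeds scaleA A scaleB B"
    and support: "\<And>\<xi> b. b \<in> B \<xi> \<Longrightarrow> b \<noteq> 0 \<Longrightarrow> \<exists>a\<in>A \<xi>. a \<noteq> 0"
  shows "graded_isomorphic scaleA A scaleB B"
proof -
  interpret A: graded_algebra scaleA A by fact
  interpret B: division_graded_algebra scaleB B by fact
  obtain \<phi> where hom: "algebra_hom scaleA scaleB \<phi>" and sub: "\<And>\<xi>. \<phi> ` A \<xi> \<subseteq> B \<xi>" and "inj \<phi>"
    using embeds unfolding graded_embeds_def graded_hom_def by blast
  interpret \<phi>: Vector_Spaces.linear scaleA scaleB \<phi>
    using hom unfolding algebra_hom_def by blast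
  have component: "\<exists>a\<in>A \<xi>. b = \<phi> a" if b: "b \<in> B \<xi>" for \<xi> b
  proof (cases "b = 0")
    case True
    then show ?thesis
      using A.subspace_component A.subspace_0 \<phi>.zero by metis
  next
    case False
    then obtain a where a: "a \<in> A \<xi>" "a \<noteq> 0" using support b by blast
    then have "\<phi> a \<noteq> 0" using \<open>inj \<phi>\<close> \<phi>.zero by (metis injD)
    then obtain c where "b = scaleB c (\<phi> a)"
      using division_graded_component_span[OF B, of "\<phi> a" \<xi> b] sub a b by blast
    then have "b = \<phi> (scaleA c a)" by (simp add: \<phi>.scale)
    then show ?thesis using a A.subspace_component A.subspace_scale by blast
  qed
  have "b \<in> range \<phi>" for b
  proof -
    obtain h where "\<And>\<xi>. B.component b \<xi> = \<phi> (h \<xi>)"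
      using component[OF B.component_in[of b]] by metis
    then have "b = \<phi> (\<Sum>\<xi> | B.component b \<xi> \<noteq> 0. h \<xi>)"
      using B.sum_component[of b] by (simp add: \<phi>.sum)
    then show ?thesis by blast
  qed
  then have "bij \<phi>" using \<open>inj \<phi>\<close> by (auto simp: bij_def)
  moreover have "\<phi> ` A \<xi> = B \<xi>" for \<xi> using sub component by blast
  ultimately show ?thesis
    unfolding graded_isomorphic_def using hom by blast
qed

lemma isomorphic_imp_embeds:
  assumes "graded_isomorphic scaleA A scaleB B"
  shows "graded_embeds scaleA A scaleB B"
  using assms unfolding graded_isomorphic_def graded_embeds_def graded_hom_def bij_def by blast

text \<open>Every substitution into \<open>B\<close> lifts along \<open>\<phi>\<close> to one into
  \<open>A\<close>, since \<open>\<phi>\<close> maps each component onto its counterpart.\<close>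

lemma isomorphic_imp_identities_subset:
  assumes A: "graded_algebra scaleA A" and B: "graded_algebra scaleB B"
    and iso: "graded_isomorphic scaleA A scaleB B"
  shows "graded_identities scaleA A \<subseteq> graded_identities scaleB B"
proof
  interpret A: graded_algebra scaleA A by fact
  interpret B: graded_algebra scaleB B by fact
  obtain \<phi> where \<phi>: "algebra_hom scaleA scaleB \<phi>" "\<And>\<xi>. \<phi> ` A \<xi> = B \<xi>"
    using iso unfolding graded_isomorphic_def by blast
  have "\<phi> 0 = 0" using \<phi>(1) by (rule algebra_hom_zero)
  fix f assume f: "f \<in> graded_identities scaleA A"
  have "evaluation scaleB \<sigma> f = 0" if \<sigma>: "\<And>i \<xi>. \<sigma> (i, \<xi>) \<in> B \<xi>" for \<sigma>
  proof -
    have "\<exists>a. a \<in> A (snd v) \<and> \<sigma> v = \<phi> a" for v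
      using \<sigma>[of "fst v" "snd v"] \<phi>(2)[of "snd v"] by auto
    then obtain \<tau> where \<tau>: "\<And>v. \<tau> v \<in> A (snd v)" "\<And>v. \<sigma> v = \<phi> (\<tau> v)" by metis
    have "\<tau> (i, \<xi>) \<in> A \<xi>" for i \<xi> using \<tau>(1)[of "(i, \<xi>)"] by simp
    then have "evaluation scaleA \<tau> f = 0"
      using f unfolding graded_identities_def by blast
    moreover have "\<sigma> = (\<lambda>v. \<phi> (\<tau> v))" using \<tau>(2) by blast
    ultimately show ?thesis
      using hom_evaluation[OF A.assoc_algebra_axioms B.assoc_algebra_axioms \<phi>(1), of \<tau> f]
        \<open>\<phi> 0 = 0\<close> by simp
  qed
  then show "f \<in> graded_identities scaleB B"
    using f unfolding graded_identities_def by blast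
qed

theorem proposition5p2:
  fixes scaleA :: "'f::alg_closed_field \<Rightarrow> 'a::ring \<Rightarrow> 'a"
    and scaleB :: "'f \<Rightarrow> 'b::ring \<Rightarrow> 'b"
    and A :: "'g::group_add \<Rightarrow> 'a set"
    and B :: "'g \<Rightarrow> 'b set"
  assumes "division_graded_algebra scaleA A" and "finite_dimensional scaleA"
    and "division_graded_algebra scaleB B" and "finite_dimensional scaleB"
  shows "(graded_identities scaleA A \<subseteq> graded_identities scaleB B \<longleftrightarrow>
            graded_embeds scaleB B scaleA A) \<and>
         (graded_identities scaleA A = graded_identities scaleB B \<longleftrightarrow>
            graded_isomorphic scaleA A scaleB B)"
proof -
  have A: "graded_algebra scaleA A" and B: "graded_algebra scaleB B"
    using assms by (simp_all add: division_graded_algebra.axioms(1))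
  have "graded_isomorphic scaleA A scaleB B"
    if eq: "graded_identities scaleA A = graded_identities scaleB B"
  proof (rule embeds_imp_isomorphic[OF A assms(3,4)])
    show "graded_embeds scaleA A scaleB B"
      using identities_subset_imp_embeds[OF assms(3,4,1,2)] eq by simp
    show "\<exists>a\<in>A \<xi>. a \<noteq> 0" if "b \<in> B \<xi>" "b \<noteq> 0" for \<xi> b
      using identities_subset_component_nonzero[OF A B _ that] eq by blast
  qed
  moreover have "graded_identities scaleA A = graded_identities scaleB B"
    if iso: "graded_isomorphic scaleA A scaleB B"
    \<comment> \<open>One inclusion lifts substitutions; the other views the isomorphism as an
      embedding of \<open>A\<close> into \<open>B\<close>.\<close>
    using isomorphic_imp_identities_subset[OF A B iso]
      embeds_imp_identities_subset[OF B A isomorphic_imp_embeds[OF iso]] by blast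
  ultimately show ?thesis
    using identities_subset_imp_embeds[OF assms] embeds_imp_identities_subset[OF A B] by blast
qed

end
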